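(* Let $\Gamma$ be a finite multiset of $D$-formulas and let $G$ be a $G$-formula. Then $\Gamma \vdash_C G$ if and only if $G \supset \bot, \Gamma \vdash_I G$.
   Context: Formulas are those of a first-order language with logical symbols $\top,\bot,\land,\lor,\supset,\exists,\forall$; $\top$ and $\bot$ are not atomic. $[t/x]B$ is capture-avoiding substitution. A sequent $\Gamma\longrightarrow\Delta$ is a pair of finite multisets of formulas; $B,\Gamma$ denotes $\Gamma$ with one extra occurrence of $B$. A sequent is an axiom if $\top\in\Delta$, or some $A$ that is $\bot$ or atomic lies in both $\Gamma$ and $\Delta$. Inference rules (upper sequents $\Rightarrow$ lower sequent): contr-L: $B,B,\Gamma\longrightarrow\Delta \Rightarrow B,\Gamma\longrightarrow\Delta$; contr-R: $\Gamma\longrightarrow\Delta,B,B\Rightarrow\Gamma\longrightarrow\Delta,B$; $\bot$-R: $\Gamma\longrightarrow\Delta,\bot\Rightarrow\Gamma\longrightarrow\Delta,D$; $\land$-L: $B,D,B\land D,\Gamma\longrightarrow\Delta\Rightarrow B\land D,\Gamma\longrightarrow\Delta$; $\land$-R: $\Gamma\longrightarrow\Delta,B$ and $\Gamma\longrightarrow\Delta,D\Rightarrow\Gamma\longrightarrow\Delta,B\land D$; $\lor$-L: $B,\Gamma\longrightarrow\Delta$ and $D,\Gamma\longrightarrow\Delta\Rightarrow B\lor D,\Gamma\longrightarrow\Delta$; $\lor$-R: $\Gamma\longrightarrow\Delta,B$ (or $\Gamma\longrightarrow\Delta,D$) $\Rightarrow\Gamma\longrightarrow\Delta,B\lor D$;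 $\supset$-L: $B\supset D,\Gamma\longrightarrow B,\Delta$ and $D,\Gamma\longrightarrow\Theta\Rightarrow B\supset D,\Gamma\longrightarrow\Delta,\Theta$; $\supset$-R: $B,\Gamma\longrightarrow\Delta,D\Rightarrow\Gamma\longrightarrow\Delta,B\supset D$; $\forall$-L: $[t/x]B,\forall x B,\Gamma\longrightarrow\Delta\Rightarrow\forall xB,\Gamma\longrightarrow\Delta$; $\exists$-R: $\Gamma\longrightarrow\Delta,[t/x]B\Rightarrow\Gamma\longrightarrow\Delta,\exists xB$ ($t$ any term); $\exists$-L: $[c/x]B,\Gamma\longrightarrow\Delta\Rightarrow\exists xB,\Gamma\longrightarrow\Delta$ and $\forall$-R: $\Gamma\longrightarrow\Delta,[c/x]B\Rightarrow\Gamma\longrightarrow\Delta,\forall xB$, where the constant $c$ does not occur in the lower sequent. A C-proof is a finite derivation tree using these rules with axioms at the leaves; $\Gamma\vdash_C B$ means $\Gamma\longrightarrow B$ has a C-proof. An I-proof is a C-proof in which every sequent has exactly one succedent formula; $\Gamma\vdash_I B$ means $\Gamma\longrightarrow B$ has an I-proof. $G$-formulas and $D$-formulas are given by the grammar $G ::= \top \mid \bot \mid A \mid G\land G \mid G\lor G \mid D\supset G \mid \exists x\, G$ and $D ::= \top \mid \bot \mid A \mid G\supset D \mid D\land D \mid D\lor D \mid \exists x\, D \mid \forall x\, D$, with $A$ ranging over atomic formulas.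
   Formalization: The language is assumed to have infinitely many constants, so that fresh constants for the rules ∃-L and ∀-R always exist; with a single constant c the claim fails for Γ = {∃x p(x)}, G = a(c) ∨ ∃x p(x). *)

theory Defs
  imports "HOL-Library.Multiset"
begin

text \<open>A symbol is a name together with an arity, so an arbitrary first-order language is
  given by sets of such pairs; the constants are the function symbols of arity 0.\<close>

record ('f, 'p) lang =
  funs :: "('f \<times> nat) set"
  preds :: "('p \<times> nat) set"

definition constants :: "('f, 'p) lang \<Rightarrow> 'f set" where
  "constants L = {c. (c, 0) \<in> funs L}"

text \<open>Bound variables are de Bruijn indices, so that formulas are identified up to renaming of
  bound variables. Under \<open>n\<close> quantifiers, an index \<open>i \<ge> n\<close> denotes the free variable \<open>i - n\<close>;
  open terms and formulas are allowed.\<close>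

datatype 'f tm = Var nat | Fun 'f "'f tm list"

datatype ('f, 'p) fm =
    Tru
  | Fls
  | Atom 'p "'f tm list"
  | And "('f, 'p) fm" "('f, 'p) fm"
  | Or "('f, 'p) fm" "('f, 'p) fm"
  | Imp "('f, 'p) fm" "('f, 'p) fm"
  | Ex "('f, 'p) fm"
  | All "('f, 'p) fm"

primrec wf_tm :: "('f, 'p) lang \<Rightarrow> 'f tm \<Rightarrow> bool" where
  "wf_tm L (Var i) \<longleftrightarrow> True"
| "wf_tm L (Fun f ts) \<longleftrightarrow> (f, length ts) \<in> funs L \<and> list_all (wf_tm L) ts"

primrec wf_fm :: "('f, 'p) lang \<Rightarrow> ('f, 'p) fm \<Rightarrow> bool" where
  "wf_fm L Tru \<longleftrightarrow> True"
| "wf_fm L Fls \<longleftrightarrow> True"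
| "wf_fm L (Atom p ts) \<longleftrightarrow> (p, length ts) \<in> preds L \<and> list_all (wf_tm L) ts"
| "wf_fm L (And B D) \<longleftrightarrow> wf_fm L B \<and> wf_fm L D"
| "wf_fm L (Or B D) \<longleftrightarrow> wf_fm L B \<and> wf_fm L D"
| "wf_fm L (Imp B D) \<longleftrightarrow> wf_fm L B \<and> wf_fm L D"
| "wf_fm L (Ex B) \<longleftrightarrow> wf_fm L B"
| "wf_fm L (All B) \<longleftrightarrow> wf_fm L B"

primrec lift_tm :: "'f tm \<Rightarrow> 'f tm" where
  "lift_tm (Var i) = Var (Suc i)"
| "lift_tm (Fun f ts) = Fun f (map lift_tm ts)"

primrec subst_tm :: "nat \<Rightarrow> 'f tm \<Rightarrow> 'f tm \<Rightarrow> 'f tm" where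
  "subst_tm k t (Var i) = (if i < k then Var i else if i = k then t else Var (i - 1))"
| "subst_tm k t (Fun f ts) = Fun f (map (subst_tm k t) ts)"

primrec subst_fm :: "nat \<Rightarrow> 'f tm \<Rightarrow> ('f, 'p) fm \<Rightarrow> ('f, 'p) fm" where
  "subst_fm k t Tru = Tru"
| "subst_fm k t Fls = Fls"
| "subst_fm k t (Atom p ts) = Atom p (map (subst_tm k t) ts)"
| "subst_fm k t (And B D) = And (subst_fm k t B) (subst_fm k t D)"
| "subst_fm k t (Or B D) = Or (subst_fm k t B) (subst_fm k t D)"
| "subst_fm k t (Imp B D) = Imp (subst_fm k t B) (subst_fm k t D)"
| "subst_fm k t (Ex B) = Ex (subst_fm (Suc k) (lift_tm t) B)"
| "subst_fm k t (All B) = All (subst_fm (Suc k) (lift_tm t) B)"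

text \<open>For a quantified formula \<open>Ex B\<close> or \<open>All B\<close>, this is the instance \<open>[t/x]B\<close> of its body.\<close>

abbreviation inst :: "'f tm \<Rightarrow> ('f, 'p) fm \<Rightarrow> ('f, 'p) fm" where
  "inst t B \<equiv> subst_fm 0 t B"

primrec consts_tm :: "'f tm \<Rightarrow> 'f set" where
  "consts_tm (Var i) = {}"
| "consts_tm (Fun f ts) = (if ts = [] then {f} else \<Union> (set (map consts_tm ts)))"

primrec consts_fm :: "('f, 'p) fm \<Rightarrow> 'f set" where
  "consts_fm Tru = {}"
| "consts_fm Fls = {}"
| "consts_fm (Atom p ts) = \<Union> (set (map consts_tm ts))"
| "consts_fm (And B D) = consts_fm B \<union> consts_fm D"
| "consts_fm (Or B D) = consts_fm B \<union> consts_fm D"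
| "consts_fm (Imp B D) = consts_fm B \<union> consts_fm D"
| "consts_fm (Ex B) = consts_fm B"
| "consts_fm (All B) = consts_fm B"

type_synonym ('f, 'p) sequent = "('f, 'p) fm multiset \<times> ('f, 'p) fm multiset"

definition consts_seq :: "('f, 'p) sequent \<Rightarrow> 'f set" where
  "consts_seq s = (\<Union>B \<in> set_mset (fst s + snd s). consts_fm B)"

primrec is_atomic :: "('f, 'p) fm \<Rightarrow> bool" where
  "is_atomic Tru \<longleftrightarrow> False"
| "is_atomic Fls \<longleftrightarrow> False"
| "is_atomic (Atom p ts) \<longleftrightarrow> True"
| "is_atomic (And B D) \<longleftrightarrow> False"
| "is_atomic (Or B D) \<longleftrightarrow> False"
| "is_atomic (Imp B D) \<longleftrightarrow> False"
| "is_atomic (Ex B) \<longleftrightarrow> False"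
| "is_atomic (All B) \<longleftrightarrow> False"

definition is_axiom :: "('f, 'p) sequent \<Rightarrow> bool" where
  "is_axiom s \<longleftrightarrow> Tru \<in># snd s \<or> (\<exists>A. (A = Fls \<or> is_atomic A) \<and> A \<in># fst s \<and> A \<in># snd s)"

text \<open>\<open>inference L ps s\<close>: some rule leads from the list \<open>ps\<close> of upper sequents to the lower
  sequent \<open>s\<close>. Only the instantiating terms have to be restricted to the language \<open>L\<close>: given that,
  if the lower sequent consists of formulas of \<open>L\<close>, then so do the upper sequents.\<close>

inductive inference ::
  "('f, 'p) lang \<Rightarrow> ('f, 'p) sequent list \<Rightarrow> ('f, 'p) sequent \<Rightarrow> bool"
  for L :: "('f, 'p) lang" where
  contr_L: "inference L [(add_mset B (add_mset B \<Gamma>), \<Delta>)] (add_mset B \<Gamma>, \<Delta>)"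
| contr_R: "inference L [(\<Gamma>, add_mset B (add_mset B \<Delta>))] (\<Gamma>, add_mset B \<Delta>)"
| Fls_R: "inference L [(\<Gamma>, add_mset Fls \<Delta>)] (\<Gamma>, add_mset D \<Delta>)"
| And_L: "inference L [(add_mset B (add_mset D (add_mset (And B D) \<Gamma>)), \<Delta>)]
    (add_mset (And B D) \<Gamma>, \<Delta>)"
| And_R: "inference L [(\<Gamma>, add_mset B \<Delta>), (\<Gamma>, add_mset D \<Delta>)] (\<Gamma>, add_mset (And B D) \<Delta>)"
| Or_L: "inference L [(add_mset B \<Gamma>, \<Delta>), (add_mset D \<Gamma>, \<Delta>)] (add_mset (Or B D) \<Gamma>, \<Delta>)"
| Or_R1: "inference L [(\<Gamma>, add_mset B \<Delta>)] (\<Gamma>, add_mset (Or B D) \<Delta>)"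
| Or_R2: "inference L [(\<Gamma>, add_mset D \<Delta>)] (\<Gamma>, add_mset (Or B D) \<Delta>)"
| Imp_L: "inference L [(add_mset (Imp B D) \<Gamma>, add_mset B \<Delta>), (add_mset D \<Gamma>, \<Theta>)]
    (add_mset (Imp B D) \<Gamma>, \<Delta> + \<Theta>)"
| Imp_R: "inference L [(add_mset B \<Gamma>, add_mset D \<Delta>)] (\<Gamma>, add_mset (Imp B D) \<Delta>)"
| All_L: "wf_tm L t \<Longrightarrow>
    inference L [(add_mset (inst t B) (add_mset (All B) \<Gamma>), \<Delta>)] (add_mset (All B) \<Gamma>, \<Delta>)"
| Ex_R: "wf_tm L t \<Longrightarrow> inference L [(\<Gamma>, add_mset (inst t B) \<Delta>)] (\<Gamma>, add_mset (Ex B) \<Delta>)"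
| Ex_L: "c \<in> constants L \<Longrightarrow> c \<notin> consts_seq (add_mset (Ex B) \<Gamma>, \<Delta>) \<Longrightarrow>
    inference L [(add_mset (inst (Fun c []) B) \<Gamma>, \<Delta>)] (add_mset (Ex B) \<Gamma>, \<Delta>)"
| All_R: "c \<in> constants L \<Longrightarrow> c \<notin> consts_seq (\<Gamma>, add_mset (All B) \<Delta>) \<Longrightarrow>
    inference L [(\<Gamma>, add_mset (inst (Fun c []) B) \<Delta>)] (\<Gamma>, add_mset (All B) \<Delta>)"

datatype (sequents: 's) derivation = Infer (concl: 's) (subderivs: "'s derivation list")

inductive c_proof :: "('f, 'p) lang \<Rightarrow> ('f, 'p) sequent derivation \<Rightarrow> bool"
  for L :: "('f, 'p) lang" where
  leaf: "is_axiom s \<Longrightarrow> c_proof L (Infer s [])"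
| step: "inference L (map concl ds) s \<Longrightarrow> \<forall>d \<in> set ds. c_proof L d \<Longrightarrow> c_proof L (Infer s ds)"

definition i_proof :: "('f, 'p) lang \<Rightarrow> ('f, 'p) sequent derivation \<Rightarrow> bool" where
  "i_proof L d \<longleftrightarrow> c_proof L d \<and> (\<forall>s \<in> sequents d. size (snd s) = 1)"

definition c_entails :: "('f, 'p) lang \<Rightarrow> ('f, 'p) fm multiset \<Rightarrow> ('f, 'p) fm \<Rightarrow> bool" where
  "c_entails L \<Gamma> B \<longleftrightarrow> (\<exists>d. c_proof L d \<and> concl d = (\<Gamma>, {#B#}))"

definition i_entails :: "('f, 'p) lang \<Rightarrow> ('f, 'p) fm multiset \<Rightarrow> ('f, 'p) fm \<Rightarrow> bool" where
  "i_entails L \<Gamma> B \<longleftrightarrow> (\<exists>d. i_proof L d \<and> concl d = (\<Gamma>, {#B#}))"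

inductive is_G :: "('f, 'p) fm \<Rightarrow> bool" and is_D :: "('f, 'p) fm \<Rightarrow> bool" where
  "is_G Tru"
| "is_G Fls"
| "is_atomic A \<Longrightarrow> is_G A"
| "is_G G1 \<Longrightarrow> is_G G2 \<Longrightarrow> is_G (And G1 G2)"
| "is_G G1 \<Longrightarrow> is_G G2 \<Longrightarrow> is_G (Or G1 G2)"
| "is_D D \<Longrightarrow> is_G G \<Longrightarrow> is_G (Imp D G)"
| "is_G G \<Longrightarrow> is_G (Ex G)"
| "is_D Tru"
| "is_D Fls"
| "is_atomic A \<Longrightarrow> is_D A"
| "is_G G \<Longrightarrow> is_D D \<Longrightarrow> is_D (Imp G D)"
| "is_D D1 \<Longrightarrow> is_D D2 \<Longrightarrow> is_D (And D1 D2)"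
| "is_D D1 \<Longrightarrow> is_D D2 \<Longrightarrow> is_D (Or D1 D2)"
| "is_D D \<Longrightarrow> is_D (Ex D)"
| "is_D D \<Longrightarrow> is_D (All D)"

end

theory Submission
  imports Defs
begin

text \<open>
  From right to left, an antecedent formula \<open>G \<supset> \<bottom>\<close> can be removed from any C-proof at the price of
  an extra succedent \<open>G\<close>: where \<open>G \<supset> \<bottom>\<close> is the principal formula, the left premise already proves
  \<open>G\<close>.

  From left to right, call a formula refutable over \<open>\<Gamma>\<close> if every extension of \<open>\<Gamma>\<close> that proves it
  intuitionistically also proves \<open>\<bottom>\<close>. Induction on a C-proof of \<open>\<Gamma> \<longrightarrow> \<Delta>\<close> shows that if all formulas
  of \<open>\<Delta>\<close> are refutable over an extension \<open>\<Gamma>'\<close> of \<open>\<Gamma>\<close>, then \<open>\<Gamma>'\<close> proves \<open>\<bottom>\<close> intuitionistically; no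
  cut is needed. The only rule for which the induction step would fail is \<open>\<forall>\<close>-R, and this
  rule cannot occur when \<open>\<Gamma>\<close> consists of \<open>D\<close>-formulas and \<open>\<Delta>\<close> of \<open>G\<close>-formulas. Since \<open>G\<close> is refutable
  over \<open>G \<supset> \<bottom>, \<Gamma>\<close>, the claim follows with \<open>\<bottom>\<close>-R.

  In both inductions the contexts grow, so eigenconstants have to be renamed on the way; the
  induction hypotheses therefore quantify over all renamings of constants.
\<close>

subsection \<open>Renaming of constants\<close>

text \<open>A name may also occur with positive arity, where it is a different symbol. Only nullary
  occurrences are therefore renamed, in agreement with \<open>consts_tm\<close>.\<close>

primrec rename_tm :: "('f \<Rightarrow> 'f) \<Rightarrow> 'f tm \<Rightarrow> 'f tm" where
  "rename_tm \<sigma> (Var i) = Var i"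
| "rename_tm \<sigma> (Fun f ts) = Fun (if ts = [] then \<sigma> f else f) (map (rename_tm \<sigma>) ts)"

primrec rename_fm :: "('f \<Rightarrow> 'f) \<Rightarrow> ('f, 'p) fm \<Rightarrow> ('f, 'p) fm" where
  "rename_fm \<sigma> Tru = Tru"
| "rename_fm \<sigma> Fls = Fls"
| "rename_fm \<sigma> (Atom p ts) = Atom p (map (rename_tm \<sigma>) ts)"
| "rename_fm \<sigma> (And B D) = And (rename_fm \<sigma> B) (rename_fm \<sigma> D)"
| "rename_fm \<sigma> (Or B D) = Or (rename_fm \<sigma> B) (rename_fm \<sigma> D)"
| "rename_fm \<sigma> (Imp B D) = Imp (rename_fm \<sigma> B) (rename_fm \<sigma> D)"
| "rename_fm \<sigma> (Ex B) = Ex (rename_fm \<sigma> B)"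
| "rename_fm \<sigma> (All B) = All (rename_fm \<sigma> B)"

lemma rename_tm_lift: "rename_tm \<sigma> (lift_tm t) = lift_tm (rename_tm \<sigma> t)"
  by (induction t) auto

lemma rename_tm_subst:
  "rename_tm \<sigma> (subst_tm k t u) = subst_tm k (rename_tm \<sigma> t) (rename_tm \<sigma> u)"
  by (induction u) auto

lemma rename_fm_subst:
  "rename_fm \<sigma> (subst_fm k t B) = subst_fm k (rename_tm \<sigma> t) (rename_fm \<sigma> B)"
  by (induction B arbitrary: k t) (auto simp: rename_tm_subst rename_tm_lift)

lemma rename_tm_cong: "\<forall>c \<in> consts_tm t. \<sigma> c = \<tau> c \<Longrightarrow> rename_tm \<sigma> t = rename_tm \<tau> t"
  by (induction t) (auto split: if_splits)

lemma rename_fm_cong: "\<forall>c \<in> consts_fm B. \<sigma> c = \<tau> c \<Longrightarrow> rename_fm \<sigma> B = rename_fm \<tau> B"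
  by (induction B) (auto intro!: rename_tm_cong)

lemma rename_tm_ident [simp]: "rename_tm (\<lambda>c. c) t = t"
  by (induction t) (auto simp: map_idI)

lemma rename_fm_ident [simp]: "rename_fm (\<lambda>c. c) B = B"
  by (induction B) (auto simp: map_idI)

lemma wf_tm_rename:
  "wf_tm L t \<Longrightarrow> \<sigma> ` constants L \<subseteq> constants L \<Longrightarrow> wf_tm L (rename_tm \<sigma> t)"
  by (induction t) (auto simp: constants_def list_all_iff image_subset_iff)

lemma is_atomic_rename: "is_atomic B \<Longrightarrow> is_atomic (rename_fm \<sigma> B)"
  by (cases B) auto

lemma rename_fm_upd_fresh: "c \<notin> consts_fm B \<Longrightarrow> rename_fm (\<sigma>(c := c')) B = rename_fm \<sigma> B"
  by (rule rename_fm_cong) auto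

text \<open>This exchanges an eigenconstant \<open>c\<close> for \<open>c'\<close>: as
  \<open>c\<close> is absent from \<open>B\<close>, the update is felt only at the constant that the
  instance inserts.\<close>

lemma rename_fm_inst_fresh:
  "c \<notin> consts_fm B \<Longrightarrow>
    rename_fm (\<sigma>(c := c')) (inst (Fun c []) B) = inst (Fun c' []) (rename_fm \<sigma> B)"
  by (simp add: rename_fm_subst rename_fm_upd_fresh)

lemma finite_consts_tm: "finite (consts_tm t)"
  by (induction t) auto

lemma finite_consts_fm: "finite (consts_fm B)"
  by (induction B) (auto simp: finite_consts_tm)

text \<open>A sequent has finitely many formulas, each with finitely many constants, so an infinite
  supply always leaves one over.\<close>

lemma ex_fresh_const:
  assumes "infinite (constants L)"
  obtains c where "c \<in> constants L" "c \<notin> consts_seq s"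
proof -
  have "finite (consts_seq s)"
    by (simp add: consts_seq_def finite_consts_fm)
  with assms have "infinite (constants L - consts_seq s)"
    by simp
  then show thesis
    using that by (metis Diff_iff finite.emptyI ex_in_conv)
qed


subsection \<open>Derivability with restricted succedents\<close>

text \<open>The parameter \<open>P\<close> serves both calculi: constant truth gives C-proofs, size
  one gives I-proofs. The derived left rules are thus proved once.\<close>

definition derivable ::
  "('f, 'p) lang \<Rightarrow> (('f, 'p) fm multiset \<Rightarrow> bool) \<Rightarrow> ('f, 'p) sequent \<Rightarrow> bool" where
  "derivable L P s \<longleftrightarrow> (\<exists>d. c_proof L d \<and> (\<forall>s' \<in> sequents d. P (snd s')) \<and> concl d = s)"

lemma concl_in_sequents: "concl d \<in> sequents d"
  by (cases d) auto

lemma derivable_succedent: "derivable L P s \<Longrightarrow> P (snd s)"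
  unfolding derivable_def using concl_in_sequents by blast

lemma derivable_axiom: "is_axiom s \<Longrightarrow> P (snd s) \<Longrightarrow> derivable L P s"
  unfolding derivable_def by (rule exI[of _ "Infer s []"]) (auto intro: c_proof.leaf)

lemma derivable_step:
  assumes "inference L ps s" "P (snd s)" "\<forall>p \<in> set ps. derivable L P p"
  shows "derivable L P s"
proof -
  \<comment> \<open>Each premise has its own tree; induction on the list of premises collects the
    trees in the order that \<open>Infer\<close> requires.\<close>
  have "\<exists>ds. map concl ds = ps \<and> (\<forall>d \<in> set ds. c_proof L d \<and> (\<forall>s' \<in> sequents d. P (snd s')))"
    using assms(3)
  proof (induction ps)
    case (Cons p ps)
    then obtain d ds where "concl d = p" "c_proof L d" "\<forall>s' \<in> sequents d. P (snd s')"
      "map concl ds = ps" "\<forall>d \<in> set ds. c_proof L d \<and> (\<forall>s' \<in> sequents d. P (snd s'))"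
      by (auto simp: derivable_def)
    then show ?case
      by (intro exI[of _ "d # ds"]) auto
  qed simp
  then obtain ds where ds: "map concl ds = ps"
    "\<forall>d \<in> set ds. c_proof L d \<and> (\<forall>s' \<in> sequents d. P (snd s'))"
    by blast
  then have "c_proof L (Infer s ds)"
    using assms(1) by (auto intro: c_proof.step)
  with ds assms(2) show ?thesis
    unfolding derivable_def by (intro exI[of _ "Infer s ds"]) auto
qed

lemma c_entails_iff_derivable: "c_entails L \<Gamma> B \<longleftrightarrow> derivable L (\<lambda>_. True) (\<Gamma>, {#B#})"
  by (simp add: c_entails_def derivable_def)

lemma i_entails_iff_derivable: "i_entails L \<Gamma> B \<longleftrightarrow> derivable L (\<lambda>\<Delta>. size \<Delta> = Suc 0) (\<Gamma>, {#B#})"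
  by (auto simp: i_entails_def i_proof_def derivable_def)

lemma derivable_mono: "derivable L P s \<Longrightarrow> (\<And>\<Delta>. P \<Delta> \<Longrightarrow> Q \<Delta>) \<Longrightarrow> derivable L Q s"
  unfolding derivable_def by blast

lemma derivable_induct [consumes 1, case_names axiom inference]:
  assumes "derivable L P s"
    and axiom: "\<And>s. is_axiom s \<Longrightarrow> Q s"
    and step: "\<And>ps s. inference L ps s \<Longrightarrow> \<forall>p \<in> set ps. Q p \<Longrightarrow> Q s"
  shows "Q s"
proof -
  obtain d where "c_proof L d" "concl d = s"
    using assms(1) by (auto simp: derivable_def)
  from this(1) have "Q (concl d)"
  proof induction
    case (leaf s)
    then show ?case by (simp add: axiom)
  next
    case (step ds s)
    then show ?case by (intro assms(3)[of "map concl ds"]) simp_all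
  qed
  with \<open>concl d = s\<close> show ?thesis by simp
qed


subsection \<open>Left rules with a persistent principal formula\<close>

text \<open>The succedent does not change, so \<open>P\<close> is inherited from the premise. Rules
  of this shape let the later inductions track antecedents only up to their sets of members.\<close>

lemma derivable_contr_L:
  assumes "derivable L P (add_mset B \<Gamma>, \<Delta>)" "B \<in># \<Gamma>"
  shows "derivable L P (\<Gamma>, \<Delta>)"
proof -
  obtain \<Gamma>' where eq: "\<Gamma> = add_mset B \<Gamma>'"
    using assms(2) by (blast dest: multi_member_split)
  show ?thesis
    unfolding eq by (intro derivable_step[OF inference.contr_L])
      (use assms(1) derivable_succedent[OF assms(1)] in \<open>auto simp: eq\<close>)
qed

lemma derivable_And_L:
  assumes "derivable L P (add_mset B (add_mset D \<Gamma>), \<Delta>)" "And B D \<in># \<Gamma>"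
  shows "derivable L P (\<Gamma>, \<Delta>)"
proof -
  obtain \<Gamma>' where eq: "\<Gamma> = add_mset (And B D) \<Gamma>'"
    using assms(2) by (blast dest: multi_member_split)
  show ?thesis
    unfolding eq by (intro derivable_step[OF inference.And_L])
      (use assms(1) derivable_succedent[OF assms(1)] in \<open>auto simp: eq\<close>)
qed

lemma derivable_All_L:
  assumes "derivable L P (add_mset (inst t B) \<Gamma>, \<Delta>)" "All B \<in># \<Gamma>" "wf_tm L t"
  shows "derivable L P (\<Gamma>, \<Delta>)"
proof -
  obtain \<Gamma>' where eq: "\<Gamma> = add_mset (All B) \<Gamma>'"
    using assms(2) by (blast dest: multi_member_split)
  show ?thesis
    unfolding eq by (intro derivable_step[OF inference.All_L])
      (use assms(1,3) derivable_succedent[OF assms(1)] in \<open>auto simp: eq\<close>)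
qed

text \<open>The primitive rule consumes its principal formula. It is applied to an additional copy,
  which contraction then absorbs; \<open>derivable_Ex_L\<close> and \<open>derivable_Imp_L\<close>
  work the same way.\<close>

lemma derivable_Or_L:
  assumes "derivable L P (add_mset B \<Gamma>, \<Delta>)" "derivable L P (add_mset D \<Gamma>, \<Delta>)" "Or B D \<in># \<Gamma>"
  shows "derivable L P (\<Gamma>, \<Delta>)"
proof (rule derivable_contr_L)
  show "derivable L P (add_mset (Or B D) \<Gamma>, \<Delta>)"
    using assms derivable_succedent[OF assms(1)]
    by (intro derivable_step[OF inference.Or_L]) auto
qed fact

lemma derivable_Ex_L:
  assumes "derivable L P (add_mset (inst (Fun c []) B) \<Gamma>, \<Delta>)" "Ex B \<in># \<Gamma>"
    "c \<in> constants L" "c \<notin> consts_seq (\<Gamma>, \<Delta>)"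
  shows "derivable L P (\<Gamma>, \<Delta>)"
proof (rule derivable_contr_L)
  have "c \<notin> consts_seq (add_mset (Ex B) \<Gamma>, \<Delta>)"
    using assms(2,4) by (auto simp: consts_seq_def)
  then show "derivable L P (add_mset (Ex B) \<Gamma>, \<Delta>)"
    using assms derivable_succedent[OF assms(1)]
    by (intro derivable_step[OF inference.Ex_L]) auto
qed fact

text \<open>The succedent \<open>\<Delta> + \<Theta>\<close> need not occur in either premise, so
  \<open>P\<close> is assumed for it separately.\<close>

lemma derivable_Imp_L:
  assumes "derivable L P (add_mset (Imp B D) \<Gamma>, add_mset B \<Delta>)" "derivable L P (add_mset D \<Gamma>, \<Theta>)"
    "Imp B D \<in># \<Gamma>" "P (\<Delta> + \<Theta>)"
  shows "derivable L P (\<Gamma>, \<Delta> + \<Theta>)"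
proof (rule derivable_contr_L)
  show "derivable L P (add_mset (Imp B D) \<Gamma>, \<Delta> + \<Theta>)"
    using assms by (intro derivable_step[OF inference.Imp_L]) auto
qed fact


subsection \<open>Moving negations from left to right\<close>

abbreviation c_derivable :: "('f, 'p) lang \<Rightarrow> ('f, 'p) sequent \<Rightarrow> bool" where
  "c_derivable L \<equiv> derivable L (\<lambda>_. True)"

lemma c_derivable_step: "inference L ps s \<Longrightarrow> \<forall>p \<in> set ps. c_derivable L p \<Longrightarrow> c_derivable L s"
  by (rule derivable_step) auto

lemma c_derivable_contr_R:
  assumes "c_derivable L (\<Gamma>, add_mset B \<Delta>)" "B \<in># \<Delta>"
  shows "c_derivable L (\<Gamma>, \<Delta>)"
proof -
  obtain \<Delta>' where eq: "\<Delta> = add_mset B \<Delta>'"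
    using assms(2) by (blast dest: multi_member_split)
  show ?thesis
    unfolding eq by (intro c_derivable_step[OF inference.contr_R])
      (use assms(1) in \<open>auto simp: eq\<close>)
qed

text \<open>Meant for \<supset>-L, which adds up the succedents of its premises and so produces
  \<open>\<Delta> + \<Delta>\<close> when both are \<open>\<Delta>\<close>.\<close>

lemma c_derivable_contr_R_mset:
  "c_derivable L (\<Gamma>, \<Delta> + \<Theta>) \<Longrightarrow> set_mset \<Delta> \<subseteq> set_mset \<Theta> \<Longrightarrow> c_derivable L (\<Gamma>, \<Theta>)"
proof (induction \<Delta>)
  case (add B \<Delta>)
  have "c_derivable L (\<Gamma>, \<Delta> + \<Theta>)"
    by (rule c_derivable_contr_R[of _ _ B]) (use add.prems in auto)
  with add show ?case by simp
qed simp

text \<open>Matching by membership builds weakening and contraction into the statement. A moved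
  negation can be principal only in \<supset>-L or contr-L: the other left rules and the axioms
  concern formulas whose images are not implications, hence lie in \<open>\<Gamma>\<close>.\<close>

lemma c_derivable_negations_to_right:
  assumes "infinite (constants L)" "c_derivable L s" "\<sigma> ` constants L \<subseteq> constants L"
    "\<forall>B \<in># fst s. rename_fm \<sigma> B \<in># \<Gamma> \<or> (\<exists>C \<in># \<Delta>. rename_fm \<sigma> B = Imp C Fls)"
    "\<forall>B \<in># snd s. rename_fm \<sigma> B \<in># \<Delta>"
  shows "c_derivable L (\<Gamma>, \<Delta>)"
  using assms(2-)
proof (induction arbitrary: \<sigma> \<Gamma> \<Delta> rule: derivable_induct)
  case (axiom s)
  have "is_axiom (\<Gamma>, \<Delta>)"
  proof (cases "Tru \<in># snd s")
    case True
    with axiom(4) show ?thesis by (force simp: is_axiom_def)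
  next
    case False
    with axiom(1) obtain A where A: "A = Fls \<or> is_atomic A" "A \<in># fst s" "A \<in># snd s"
      by (auto simp: is_axiom_def)
    then have "rename_fm \<sigma> A = Fls \<or> is_atomic (rename_fm \<sigma> A)"
      by (auto simp: is_atomic_rename)
    \<comment> \<open>The image of \<open>A\<close> is \<bottom> or atomic, hence no implication,
      which rules out the second alternative for antecedent formulas.\<close>
    moreover from this A(2,3) axiom(3,4) have "rename_fm \<sigma> A \<in># \<Gamma>" "rename_fm \<sigma> A \<in># \<Delta>"
      by (fastforce, blast)
    ultimately show ?thesis by (auto simp: is_axiom_def)
  qed
  then show ?case by (rule derivable_axiom) simp
next
  case (inference ps s)
  note \<sigma> = inference(3) and sub = inference(4,5)
  have IH: "c_derivable L (\<Gamma>', \<Delta>')"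
    if "p \<in> set ps" "\<tau> ` constants L \<subseteq> constants L"
      "\<forall>B \<in># fst p. rename_fm \<tau> B \<in># \<Gamma>' \<or> (\<exists>C \<in># \<Delta>'. rename_fm \<tau> B = Imp C Fls)"
      "\<forall>B \<in># snd p. rename_fm \<tau> B \<in># \<Delta>'" for p \<tau> \<Gamma>' \<Delta>'
    using inference(2) that by blast
  from inference(1) show ?case
  proof (cases rule: inference.cases)
    case (contr_L B \<Gamma>0 \<Delta>0)
    show ?thesis
      by (rule IH[of _ \<sigma>]) (use \<sigma> sub in \<open>(force simp: contr_L)+\<close>)
  next
    case (contr_R \<Gamma>0 B \<Delta>0)
    show ?thesis
      by (rule IH[of _ \<sigma>]) (use \<sigma> sub in \<open>(force simp: contr_R)+\<close>)
  next
    case (Fls_R \<Gamma>0 \<Delta>0 D)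
    \<comment> \<open>Pattern of the right rules: enlarge \<open>\<Delta>\<close> by the active
      formula, apply the rule, and contract the principal formula into the copy already in
      \<open>\<Delta>\<close>.\<close>
    have "c_derivable L (\<Gamma>, add_mset Fls \<Delta>)"
      by (rule IH[of _ \<sigma>]) (use \<sigma> sub in \<open>(force simp: Fls_R)+\<close>)
    then have "c_derivable L (\<Gamma>, add_mset (rename_fm \<sigma> D) \<Delta>)"
      by (intro c_derivable_step[OF inference.Fls_R]) auto
    then show ?thesis
      by (rule c_derivable_contr_R) (use sub in \<open>auto simp: Fls_R\<close>)
  next
    case (And_L B D \<Gamma>0 \<Delta>0)
    let ?B = "rename_fm \<sigma> B" and ?D = "rename_fm \<sigma> D"
    have "c_derivable L (add_mset ?B (add_mset ?D \<Gamma>), \<Delta>)"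
      by (rule IH[of _ \<sigma>]) (use \<sigma> sub in \<open>(force simp: And_L)+\<close>)
    then show ?thesis
      by (rule derivable_And_L) (use sub in \<open>auto simp: And_L\<close>)
  next
    case (And_R \<Gamma>0 B \<Delta>0 D)
    let ?B = "rename_fm \<sigma> B" and ?D = "rename_fm \<sigma> D"
    have left: "c_derivable L (\<Gamma>, add_mset ?B \<Delta>)"
      by (rule IH[of "(\<Gamma>0, add_mset B \<Delta>0)" \<sigma>]) (use \<sigma> sub in \<open>(force simp: And_R)+\<close>)
    have right: "c_derivable L (\<Gamma>, add_mset ?D \<Delta>)"
      by (rule IH[of "(\<Gamma>0, add_mset D \<Delta>0)" \<sigma>]) (use \<sigma> sub in \<open>(force simp: And_R)+\<close>)
    from left right have "c_derivable L (\<Gamma>, add_mset (And ?B ?D) \<Delta>)"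
      by (intro c_derivable_step[OF inference.And_R]) auto
    then show ?thesis
      by (rule c_derivable_contr_R) (use sub in \<open>auto simp: And_R\<close>)
  next
    case (Or_L B \<Gamma>0 \<Delta>0 D)
    let ?B = "rename_fm \<sigma> B" and ?D = "rename_fm \<sigma> D"
    have left: "c_derivable L (add_mset ?B \<Gamma>, \<Delta>)"
      by (rule IH[of "(add_mset B \<Gamma>0, \<Delta>0)" \<sigma>]) (use \<sigma> sub in \<open>(force simp: Or_L)+\<close>)
    have right: "c_derivable L (add_mset ?D \<Gamma>, \<Delta>)"
      by (rule IH[of "(add_mset D \<Gamma>0, \<Delta>0)" \<sigma>]) (use \<sigma> sub in \<open>(force simp: Or_L)+\<close>)
    from left right show ?thesis
      by (rule derivable_Or_L) (use sub in \<open>auto simp: Or_L\<close>)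
  next
    case (Or_R1 \<Gamma>0 B \<Delta>0 D)
    let ?B = "rename_fm \<sigma> B" and ?D = "rename_fm \<sigma> D"
    have "c_derivable L (\<Gamma>, add_mset ?B \<Delta>)"
      by (rule IH[of _ \<sigma>]) (use \<sigma> sub in \<open>(force simp: Or_R1)+\<close>)
    then have "c_derivable L (\<Gamma>, add_mset (Or ?B ?D) \<Delta>)"
      by (intro c_derivable_step[OF inference.Or_R1]) auto
    then show ?thesis
      by (rule c_derivable_contr_R) (use sub in \<open>auto simp: Or_R1\<close>)
  next
    case (Or_R2 \<Gamma>0 D \<Delta>0 B)
    let ?B = "rename_fm \<sigma> B" and ?D = "rename_fm \<sigma> D"
    have "c_derivable L (\<Gamma>, add_mset ?D \<Delta>)"
      by (rule IH[of _ \<sigma>]) (use \<sigma> sub in \<open>(force simp: Or_R2)+\<close>)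
    then have "c_derivable L (\<Gamma>, add_mset (Or ?B ?D) \<Delta>)"
      by (intro c_derivable_step[OF inference.Or_R2]) auto
    then show ?thesis
      by (rule c_derivable_contr_R) (use sub in \<open>auto simp: Or_R2\<close>)
  next
    case (Imp_L B D \<Gamma>0 \<Delta>0 \<Theta>0)
    let ?B = "rename_fm \<sigma> B" and ?D = "rename_fm \<sigma> D"
    show ?thesis
    \<comment> \<open>If the implication is matched both on the left and on the right, the first
      branch covers it; the second is left with membership in \<open>\<Gamma>\<close> alone.\<close>
    proof (cases "?D = Fls \<and> ?B \<in># \<Delta>")
      case True
      then show ?thesis
        by (intro IH[of "(add_mset (Imp B D) \<Gamma>0, add_mset B \<Delta>0)" \<sigma>])
          (use \<sigma> sub in \<open>(force simp: Imp_L)+\<close>)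
    next
      case False
      then have imp: "Imp ?B ?D \<in># \<Gamma>"
        using sub by (auto simp: Imp_L)
      have left: "c_derivable L (add_mset (Imp ?B ?D) \<Gamma>, add_mset ?B \<Delta>)"
        by (rule IH[of "(add_mset (Imp B D) \<Gamma>0, add_mset B \<Delta>0)" \<sigma>])
          (use \<sigma> sub in \<open>(force simp: Imp_L)+\<close>)
      have right: "c_derivable L (add_mset ?D \<Gamma>, \<Delta>)"
        by (rule IH[of "(add_mset D \<Gamma>0, \<Theta>0)" \<sigma>]) (use \<sigma> sub in \<open>(force simp: Imp_L)+\<close>)
      from left right imp have "c_derivable L (\<Gamma>, \<Delta> + \<Delta>)"
        by (rule derivable_Imp_L) simp
      then show ?thesis by (rule c_derivable_contr_R_mset) simp
    qed
  next
    case (Imp_R B \<Gamma>0 D \<Delta>0)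
    let ?B = "rename_fm \<sigma> B" and ?D = "rename_fm \<sigma> D"
    have "c_derivable L (add_mset ?B \<Gamma>, add_mset ?D \<Delta>)"
      by (rule IH[of _ \<sigma>]) (use \<sigma> sub in \<open>(force simp: Imp_R)+\<close>)
    then have "c_derivable L (\<Gamma>, add_mset (Imp ?B ?D) \<Delta>)"
      by (intro c_derivable_step[OF inference.Imp_R]) auto
    then show ?thesis
      by (rule c_derivable_contr_R) (use sub in \<open>auto simp: Imp_R\<close>)
  next
    case (All_L t B \<Gamma>0 \<Delta>0)
    let ?t = "rename_tm \<sigma> t" and ?B = "rename_fm \<sigma> B"
    have "c_derivable L (add_mset (inst ?t ?B) \<Gamma>, \<Delta>)"
      by (rule IH[of _ \<sigma>]) (use \<sigma> sub in \<open>(force simp: All_L rename_fm_subst)+\<close>)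
    then show ?thesis
      by (rule derivable_All_L[OF _ _ wf_tm_rename[OF All_L(3) \<sigma>]])
        (use sub in \<open>auto simp: All_L\<close>)
  next
    case (Ex_R t \<Gamma>0 B \<Delta>0)
    let ?t = "rename_tm \<sigma> t" and ?B = "rename_fm \<sigma> B"
    have "c_derivable L (\<Gamma>, add_mset (inst ?t ?B) \<Delta>)"
      by (rule IH[of _ \<sigma>]) (use \<sigma> sub in \<open>(force simp: Ex_R rename_fm_subst)+\<close>)
    then have "c_derivable L (\<Gamma>, add_mset (Ex ?B) \<Delta>)"
      using wf_tm_rename[OF Ex_R(3) \<sigma>] by (intro c_derivable_step[OF inference.Ex_R]) auto
    then show ?thesis
      by (rule c_derivable_contr_R) (use sub in \<open>auto simp: Ex_R\<close>)
  next
    case (Ex_L c B \<Gamma>0 \<Delta>0)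
    let ?B = "rename_fm \<sigma> B"
    \<comment> \<open>The old \<open>c\<close> may occur in the enlarged contexts. Since it is
      absent from \<open>B\<close> and the side formulas, \<open>?\<tau>\<close> acts on them as
      \<open>\<sigma>\<close> does and the matching survives.\<close>
    obtain c' where c': "c' \<in> constants L" "c' \<notin> consts_seq (\<Gamma>, \<Delta>)"
      using ex_fresh_const[OF assms(1)] .
    let ?\<tau> = "\<sigma>(c := c')"
    have fresh: "c \<notin> consts_fm B" "\<forall>A \<in># \<Gamma>0. c \<notin> consts_fm A" "\<forall>A \<in># \<Delta>0. c \<notin> consts_fm A"
      using Ex_L(4) by (auto simp: consts_seq_def)
    have "?\<tau> ` constants L \<subseteq> constants L"
      using \<sigma> c'(1) by auto
    then have "c_derivable L (add_mset (inst (Fun c' []) ?B) \<Gamma>, \<Delta>)"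
      by (intro IH[of _ ?\<tau>])
        (use sub fresh in \<open>(force simp: Ex_L rename_fm_inst_fresh rename_fm_upd_fresh
            simp del: fun_upd_apply)+\<close>)
    then show ?thesis
      by (rule derivable_Ex_L) (use sub c' in \<open>auto simp: Ex_L\<close>)
  next
    case (All_R c \<Gamma>0 B \<Delta>0)
    let ?B = "rename_fm \<sigma> B"
    obtain c' where c': "c' \<in> constants L" "c' \<notin> consts_seq (\<Gamma>, add_mset (All ?B) \<Delta>)"
      using ex_fresh_const[OF assms(1)] .
    let ?\<tau> = "\<sigma>(c := c')"
    have fresh: "c \<notin> consts_fm B" "\<forall>A \<in># \<Gamma>0. c \<notin> consts_fm A" "\<forall>A \<in># \<Delta>0. c \<notin> consts_fm A"
      using All_R(4) by (auto simp: consts_seq_def)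
    have "?\<tau> ` constants L \<subseteq> constants L"
      using \<sigma> c'(1) by auto
    then have "c_derivable L (\<Gamma>, add_mset (inst (Fun c' []) ?B) \<Delta>)"
      by (intro IH[of _ ?\<tau>])
        (use sub fresh in \<open>(force simp: All_R rename_fm_inst_fresh rename_fm_upd_fresh
            simp del: fun_upd_apply)+\<close>)
    then have "c_derivable L (\<Gamma>, add_mset (All ?B) \<Delta>)"
      using c' by (intro c_derivable_step[OF inference.All_R]) auto
    then show ?thesis
      by (rule c_derivable_contr_R) (use sub in \<open>auto simp: All_R\<close>)
  qed
qed


subsection \<open>Refutable formulas\<close>

abbreviation i_derivable :: "('f, 'p) lang \<Rightarrow> ('f, 'p) fm multiset \<Rightarrow> ('f, 'p) fm \<Rightarrow> bool" where
  "i_derivable L \<Gamma> B \<equiv> derivable L (\<lambda>\<Delta>. size \<Delta> = Suc 0) (\<Gamma>, {#B#})"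

lemma i_derivable_step:
  "inference L ps (\<Gamma>, {#B#}) \<Longrightarrow> \<forall>p \<in> set ps. derivable L (\<lambda>\<Delta>. size \<Delta> = Suc 0) p \<Longrightarrow>
    i_derivable L \<Gamma> B"
  by (rule derivable_step) auto

lemma i_derivable_Fls_R: "i_derivable L \<Gamma> Fls \<Longrightarrow> i_derivable L \<Gamma> B"
  by (rule i_derivable_step[OF inference.Fls_R]) auto

lemma i_derivable_Imp_R: "i_derivable L (add_mset B \<Gamma>) D \<Longrightarrow> i_derivable L \<Gamma> (Imp B D)"
  by (rule i_derivable_step[OF inference.Imp_R]) auto

lemma i_derivable_Imp_L:
  "i_derivable L (add_mset (Imp B D) \<Gamma>) B \<Longrightarrow> i_derivable L (add_mset D \<Gamma>) C \<Longrightarrow>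
    Imp B D \<in># \<Gamma> \<Longrightarrow> i_derivable L \<Gamma> C"
  using derivable_Imp_L[of L "\<lambda>\<Delta>. size \<Delta> = Suc 0" B D \<Gamma> "{#}" "{#C#}"] by simp

text \<open>Closing under extensions by definition makes the admissibility of weakening for I-proofs
  unnecessary.\<close>

definition stably_derivable ::
  "('f, 'p) lang \<Rightarrow> ('f, 'p) fm multiset \<Rightarrow> ('f, 'p) fm \<Rightarrow> bool" where
  "stably_derivable L \<Gamma> B \<longleftrightarrow> (\<forall>\<Gamma>'. set_mset \<Gamma> \<subseteq> set_mset \<Gamma>' \<longrightarrow> i_derivable L \<Gamma>' B)"

text \<open>This is Kripke forcing of the negation of \<open>B\<close>: worlds are contexts ordered
  by inclusion of their sets of members, and falsity holds where \<bottom> has an I-proof.\<close>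

definition refutable :: "('f, 'p) lang \<Rightarrow> ('f, 'p) fm multiset \<Rightarrow> ('f, 'p) fm \<Rightarrow> bool" where
  "refutable L \<Gamma> B \<longleftrightarrow>
    (\<forall>\<Gamma>'. set_mset \<Gamma> \<subseteq> set_mset \<Gamma>' \<longrightarrow> stably_derivable L \<Gamma>' B \<longrightarrow> i_derivable L \<Gamma>' Fls)"

lemma stably_derivable_mono:
  "stably_derivable L \<Gamma> B \<Longrightarrow> set_mset \<Gamma> \<subseteq> set_mset \<Gamma>' \<Longrightarrow> stably_derivable L \<Gamma>' B"
  unfolding stably_derivable_def by blast

lemma refutable_mono: "refutable L \<Gamma> B \<Longrightarrow> set_mset \<Gamma> \<subseteq> set_mset \<Gamma>' \<Longrightarrow> refutable L \<Gamma>' B"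
  unfolding refutable_def by blast

lemma stably_derivableD: "stably_derivable L \<Gamma> B \<Longrightarrow> i_derivable L \<Gamma> B"
  unfolding stably_derivable_def by blast

lemma refutableD: "refutable L \<Gamma> B \<Longrightarrow> stably_derivable L \<Gamma> B \<Longrightarrow> i_derivable L \<Gamma> Fls"
  unfolding refutable_def by blast

lemma refutableI:
  "(\<And>\<Gamma>'. set_mset \<Gamma> \<subseteq> set_mset \<Gamma>' \<Longrightarrow> stably_derivable L \<Gamma>' B \<Longrightarrow> i_derivable L \<Gamma>' Fls) \<Longrightarrow>
    refutable L \<Gamma> B"
  unfolding refutable_def by blast

lemma refutable_Fls: "refutable L \<Gamma> Fls"
  by (rule refutableI) (rule stably_derivableD)

text \<open>Contraposition: stable derivability of \<open>B\<close> persists in further extensions,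
  so it yields \<open>C\<close> in all of them. For a right rule, \<open>B\<close> is an active
  formula and \<open>C\<close> the principal one.\<close>

lemma refutable_antimono:
  assumes "refutable L \<Gamma> C"
    "\<And>\<Gamma>'. set_mset \<Gamma> \<subseteq> set_mset \<Gamma>' \<Longrightarrow> stably_derivable L \<Gamma>' B \<Longrightarrow> i_derivable L \<Gamma>' C"
  shows "refutable L \<Gamma> B"
proof (rule refutableI)
  fix \<Gamma>' assume \<Gamma>': "set_mset \<Gamma> \<subseteq> set_mset \<Gamma>'" "stably_derivable L \<Gamma>' B"
  have "stably_derivable L \<Gamma>' C"
    unfolding stably_derivable_def
  proof (intro allI impI assms(2))
    fix \<Gamma>'' assume "set_mset \<Gamma>' \<subseteq> set_mset \<Gamma>''"
    with \<Gamma>' show "set_mset \<Gamma> \<subseteq> set_mset \<Gamma>''" "stably_derivable L \<Gamma>'' B"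
      by (auto intro: stably_derivable_mono)
  qed
  with refutable_mono[OF assms(1) \<Gamma>'(1)] show "i_derivable L \<Gamma>' Fls"
    by (rule refutableD)
qed

text \<open>Apply \<supset>-L with an axiom on \<bottom> as right premise. Stability supplies the
  left premise, whose antecedent has one more copy of the implication.\<close>

lemma refutable_Imp:
  assumes "Imp B Fls \<in># \<Gamma>"
  shows "refutable L \<Gamma> B"
proof (rule refutableI)
  fix \<Gamma>' assume "set_mset \<Gamma> \<subseteq> set_mset \<Gamma>'" "stably_derivable L \<Gamma>' B"
  then have "i_derivable L (add_mset (Imp B Fls) \<Gamma>') B" and imp: "Imp B Fls \<in># \<Gamma>'"
    using assms by (auto simp: stably_derivable_def subset_insertI2)
  moreover have "i_derivable L (add_mset Fls \<Gamma>') Fls"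
    by (rule derivable_axiom) (auto simp: is_axiom_def)
  ultimately show "i_derivable L \<Gamma>' Fls"
    using i_derivable_Imp_L by metis
qed


subsection \<open>From C-proofs to I-proofs\<close>

lemma is_G_simps [simp]:
  "is_G (And B D) \<longleftrightarrow> is_G B \<and> is_G D"
  "is_G (Or B D) \<longleftrightarrow> is_G B \<and> is_G D"
  "is_G (Imp B D) \<longleftrightarrow> is_D B \<and> is_G D"
  "is_G (Ex B) \<longleftrightarrow> is_G B"
  "\<not> is_G (All B)"
  "is_G Fls"
  by (subst is_G.simps; simp)+

lemma is_D_simps [simp]:
  "is_D (And B D) \<longleftrightarrow> is_D B \<and> is_D D"
  "is_D (Or B D) \<longleftrightarrow> is_D B \<and> is_D D"
  "is_D (Imp B D) \<longleftrightarrow> is_G B \<and> is_D D"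
  "is_D (Ex B) \<longleftrightarrow> is_D B"
  "is_D (All B) \<longleftrightarrow> is_D B"
  by (subst is_D.simps; simp)+

lemma is_atomic_subst: "is_atomic B \<Longrightarrow> is_atomic (subst_fm k t B)"
  by (cases B) auto

lemma is_G_subst: "is_G B \<Longrightarrow> is_G (subst_fm k t B)"
  and is_D_subst: "is_D B \<Longrightarrow> is_D (subst_fm k t B)"
  by (induction arbitrary: k t and k t rule: is_G_is_D.inducts)
    (auto intro: is_G_is_D.intros is_atomic_subst)

text \<open>The whole succedent becomes a family of refutability assumptions, so the constructed
  proof only ever needs the single succedent \<bottom>. Left rules are replayed with that succedent;
  right rules transfer refutability to the active formulas.\<close>

lemma c_derivable_imp_i_derivable_Fls:
  assumes "infinite (constants L)" "c_derivable L s"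
    "\<forall>B \<in># fst s. is_D B" "\<forall>B \<in># snd s. is_G B"
    "\<sigma> ` constants L \<subseteq> constants L"
    "\<forall>B \<in># fst s. rename_fm \<sigma> B \<in># \<Gamma>"
    "\<forall>B \<in># snd s. refutable L \<Gamma> (rename_fm \<sigma> B)"
  shows "i_derivable L \<Gamma> Fls"
  using assms(2-)
proof (induction arbitrary: \<sigma> \<Gamma> rule: derivable_induct)
  case (axiom s)
  show ?case
  proof (cases "Tru \<in># snd s")
    case True
    with axiom(6) have "refutable L \<Gamma> Tru" by force
    moreover have "stably_derivable L \<Gamma> Tru"
      unfolding stably_derivable_def by (auto intro!: derivable_axiom simp: is_axiom_def)
    ultimately show ?thesis by (rule refutableD)
  next
    case False
    with axiom(1) obtain A where A: "A = Fls \<or> is_atomic A" "A \<in># fst s" "A \<in># snd s"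
      by (auto simp: is_axiom_def)
    then have "rename_fm \<sigma> A = Fls \<or> is_atomic (rename_fm \<sigma> A)" "rename_fm \<sigma> A \<in># \<Gamma>"
      using axiom(5) by (auto simp: is_atomic_rename)
    then have "stably_derivable L \<Gamma> (rename_fm \<sigma> A)"
      unfolding stably_derivable_def by (auto intro!: derivable_axiom simp: is_axiom_def)
    with A(3) axiom(6) show ?thesis by (blast intro: refutableD)
  qed
next
  case (inference ps s)
  note GD = inference(3,4) and \<sigma> = inference(5) and sub = inference(6)
  have refut: "refutable L \<Gamma>' (rename_fm \<sigma> B)"
    if "B \<in># snd s" "set_mset \<Gamma> \<subseteq> set_mset \<Gamma>'" for B \<Gamma>'
    using inference(7) that by (blast intro: refutable_mono)
  have IH: "i_derivable L \<Gamma>' Fls"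
    if "p \<in> set ps" "\<forall>B \<in># fst p. is_D B" "\<forall>B \<in># snd p. is_G B"
      "\<forall>B \<in># fst p. rename_fm \<sigma> B \<in># \<Gamma>'"
      "\<forall>B \<in># snd p. refutable L \<Gamma>' (rename_fm \<sigma> B)" for p \<Gamma>'
    using inference(2) \<sigma> that by blast
  from inference(1) show ?case
  proof (cases rule: inference.cases)
    case (contr_L B \<Gamma>0 \<Delta>0)
    show ?thesis
      by (rule IH) (use GD sub refut in \<open>auto simp: contr_L\<close>)
  next
    case (contr_R \<Gamma>0 B \<Delta>0)
    show ?thesis
      by (rule IH) (use GD sub refut in \<open>auto simp: contr_R\<close>)
  next
    case (Fls_R \<Gamma>0 \<Delta>0 D)
    show ?thesis
      by (rule IH) (use GD sub refut in \<open>auto simp: Fls_R refutable_Fls\<close>)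
  next
    case (And_L B D \<Gamma>0 \<Delta>0)
    let ?B = "rename_fm \<sigma> B" and ?D = "rename_fm \<sigma> D"
    have "i_derivable L (add_mset ?B (add_mset ?D \<Gamma>)) Fls"
      by (rule IH) (use GD sub refut in \<open>auto simp: And_L subset_insertI2\<close>)
    then show ?thesis
      by (rule derivable_And_L) (use sub in \<open>auto simp: And_L\<close>)
  next
    case (And_R \<Gamma>0 B \<Delta>0 D)
    let ?B = "rename_fm \<sigma> B" and ?D = "rename_fm \<sigma> D"
    have BD: "refutable L \<Gamma> (And ?B ?D)"
      using refut[of "And B D" \<Gamma>] by (simp add: And_R)
    \<comment> \<open>Where \<open>?B\<close> is provable, a proof of \<open>?D\<close> would
      complete one of the conjunction, so \<open>?D\<close> is refutable there and the right premise
      gives \<bottom>. Hence \<open>?B\<close> is refutable, and the left premise applies.\<close>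
    have "refutable L \<Gamma> ?B"
    proof (rule refutableI)
      fix \<Gamma>' assume \<Gamma>': "set_mset \<Gamma> \<subseteq> set_mset \<Gamma>'" "stably_derivable L \<Gamma>' ?B"
      have "refutable L \<Gamma>' ?D"
      proof (rule refutable_antimono)
        show "refutable L \<Gamma>' (And ?B ?D)"
          using BD \<Gamma>'(1) by (rule refutable_mono)
        fix \<Gamma>'' assume "set_mset \<Gamma>' \<subseteq> set_mset \<Gamma>''" "stably_derivable L \<Gamma>'' ?D"
        then have "i_derivable L \<Gamma>'' ?B" "i_derivable L \<Gamma>'' ?D"
          using \<Gamma>'(2) by (auto intro: stably_derivableD stably_derivable_mono)
        then show "i_derivable L \<Gamma>'' (And ?B ?D)"
          by (intro i_derivable_step[OF inference.And_R]) auto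
      qed
      then show "i_derivable L \<Gamma>' Fls"
        by (intro IH[of "(\<Gamma>0, add_mset D \<Delta>0)"])
          (use GD sub refut \<Gamma>' in \<open>auto simp: And_R\<close>)
    qed
    then show ?thesis
      by (intro IH[of "(\<Gamma>0, add_mset B \<Delta>0)"]) (use GD sub refut in \<open>auto simp: And_R\<close>)
  next
    case (Or_L B \<Gamma>0 \<Delta>0 D)
    let ?B = "rename_fm \<sigma> B" and ?D = "rename_fm \<sigma> D"
    have "i_derivable L (add_mset ?B \<Gamma>) Fls"
      by (rule IH[of "(add_mset B \<Gamma>0, \<Delta>0)"])
        (use GD sub refut in \<open>auto simp: Or_L subset_insertI2\<close>)
    moreover have "i_derivable L (add_mset ?D \<Gamma>) Fls"
      by (rule IH[of "(add_mset D \<Gamma>0, \<Delta>0)"])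
        (use GD sub refut in \<open>auto simp: Or_L subset_insertI2\<close>)
    ultimately show ?thesis
      by (rule derivable_Or_L) (use sub in \<open>auto simp: Or_L\<close>)
  next
    case (Or_R1 \<Gamma>0 B \<Delta>0 D)
    have "refutable L \<Gamma> (Or (rename_fm \<sigma> B) (rename_fm \<sigma> D))"
      using refut[of "Or B D" \<Gamma>] by (simp add: Or_R1)
    then have "refutable L \<Gamma> (rename_fm \<sigma> B)"
      by (rule refutable_antimono)
        (rule i_derivable_step[OF inference.Or_R1], simp add: stably_derivableD)
    then show ?thesis
      by (intro IH) (use GD sub refut in \<open>auto simp: Or_R1\<close>)
  next
    case (Or_R2 \<Gamma>0 D \<Delta>0 B)
    have "refutable L \<Gamma> (Or (rename_fm \<sigma> B) (rename_fm \<sigma> D))"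
      using refut[of "Or B D" \<Gamma>] by (simp add: Or_R2)
    then have "refutable L \<Gamma> (rename_fm \<sigma> D)"
      by (rule refutable_antimono)
        (rule i_derivable_step[OF inference.Or_R2], simp add: stably_derivableD)
    then show ?thesis
      by (intro IH) (use GD sub refut in \<open>auto simp: Or_R2\<close>)
  next
    case (Imp_L B D \<Gamma>0 \<Delta>0 \<Theta>0)
    let ?B = "rename_fm \<sigma> B" and ?D = "rename_fm \<sigma> D"
    \<comment> \<open>The right premise gives \<bottom> from \<open>?D\<close>; so wherever
      \<open>?B\<close> is provable, \<supset>-L gives \<bottom>. The left premise can then be
      used.\<close>
    have "refutable L \<Gamma> ?B"
    proof (rule refutableI)
      fix \<Gamma>' assume \<Gamma>': "set_mset \<Gamma> \<subseteq> set_mset \<Gamma>'" "stably_derivable L \<Gamma>' ?B"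
      have "i_derivable L (add_mset (Imp ?B ?D) \<Gamma>') ?B"
        using \<Gamma>'(2) by (auto simp: stably_derivable_def subset_insertI2)
      moreover have "i_derivable L (add_mset ?D \<Gamma>') Fls"
        by (rule IH[of "(add_mset D \<Gamma>0, \<Theta>0)"])
          (use GD sub refut \<Gamma>' in \<open>auto simp: Imp_L subset_insertI2\<close>)
      ultimately show "i_derivable L \<Gamma>' Fls"
        by (rule i_derivable_Imp_L) (use sub \<Gamma>'(1) in \<open>auto simp: Imp_L\<close>)
    qed
    then show ?thesis
      by (intro IH[of "(add_mset (Imp B D) \<Gamma>0, add_mset B \<Delta>0)"])
        (use GD sub refut in \<open>auto simp: Imp_L subset_insertI2\<close>)
  next
    case (Imp_R B \<Gamma>0 D \<Delta>0)
    let ?B = "rename_fm \<sigma> B" and ?D = "rename_fm \<sigma> D"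
    have BD: "refutable L \<Gamma> (Imp ?B ?D)"
      using refut[of "Imp B D" \<Gamma>] by (simp add: Imp_R)
    \<comment> \<open>With \<open>?B\<close> assumed, \<open>?D\<close> is refutable, because a
      proof of \<open>?D\<close> yields the implication. The premise then gives \<bottom>, and
      \<bottom>-R turns it into \<open>?D\<close>: the implication is proved after all, contrary to
      its refutability.\<close>
    have "stably_derivable L \<Gamma> (Imp ?B ?D)"
      unfolding stably_derivable_def
    proof (intro allI impI i_derivable_Imp_R)
      fix \<Gamma>' assume \<Gamma>': "set_mset \<Gamma> \<subseteq> set_mset \<Gamma>'"
      have "refutable L (add_mset ?B \<Gamma>') (Imp ?B ?D)"
        using BD by (rule refutable_mono) (use \<Gamma>' in auto)
      then have "refutable L (add_mset ?B \<Gamma>') ?D"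
      proof (rule refutable_antimono)
        fix \<Gamma>'' assume "stably_derivable L \<Gamma>'' ?D"
        then show "i_derivable L \<Gamma>'' (Imp ?B ?D)"
          by (intro i_derivable_Imp_R) (auto simp: stably_derivable_def subset_insertI2)
      qed
      then have "i_derivable L (add_mset ?B \<Gamma>') Fls"
        by (intro IH) (use GD sub refut \<Gamma>' in \<open>auto simp: Imp_R subset_insertI2\<close>)
      then show "i_derivable L (add_mset ?B \<Gamma>') ?D"
        by (rule i_derivable_Fls_R)
    qed
    with BD show ?thesis by (rule refutableD)
  next
    case (All_L t B \<Gamma>0 \<Delta>0)
    let ?t = "rename_tm \<sigma> t" and ?B = "rename_fm \<sigma> B"
    have "i_derivable L (add_mset (inst ?t ?B) \<Gamma>) Fls"
      by (rule IH)
        (use GD sub refut in \<open>auto simp: All_L subset_insertI2 rename_fm_subst is_D_subst\<close>)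
    then show ?thesis
      by (rule derivable_All_L[OF _ _ wf_tm_rename[OF All_L(3) \<sigma>]])
        (use sub in \<open>auto simp: All_L\<close>)
  next
    case (Ex_R t \<Gamma>0 B \<Delta>0)
    let ?t = "rename_tm \<sigma> t" and ?B = "rename_fm \<sigma> B"
    have "refutable L \<Gamma> (Ex ?B)"
      using refut[of "Ex B" \<Gamma>] by (simp add: Ex_R)
    then have "refutable L \<Gamma> (inst ?t ?B)"
      by (rule refutable_antimono)
        (rule i_derivable_step[OF inference.Ex_R[OF wf_tm_rename[OF Ex_R(3) \<sigma>]]],
          simp add: stably_derivableD)
    then show ?thesis
      by (intro IH) (use GD sub refut in \<open>auto simp: Ex_R rename_fm_subst is_G_subst\<close>)
  next
    case (Ex_L c B \<Gamma>0 \<Delta>0)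
    let ?B = "rename_fm \<sigma> B"
    \<comment> \<open>Freshness is needed only for \<open>\<Gamma>\<close> and \<bottom>, since the
      rule is applied in the I-proof under construction.\<close>
    obtain c' where c': "c' \<in> constants L" "c' \<notin> consts_seq (\<Gamma>, {#Fls#})"
      using ex_fresh_const[OF assms(1)] .
    let ?\<tau> = "\<sigma>(c := c')"
    have fresh: "c \<notin> consts_fm B" "\<forall>A \<in># \<Gamma>0. c \<notin> consts_fm A" "\<forall>A \<in># \<Delta>0. c \<notin> consts_fm A"
      using Ex_L(4) by (auto simp: consts_seq_def)
    have "?\<tau> ` constants L \<subseteq> constants L"
      using \<sigma> c'(1) by auto
    then have "i_derivable L (add_mset (inst (Fun c' []) ?B) \<Gamma>) Fls"
      \<comment> \<open>The local \<open>IH\<close> is tied to \<open>\<sigma>\<close>, so the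
        original hypothesis is instantiated with \<open>?\<tau>\<close>.\<close>
      by (intro inference(2)[rule_format, of "(add_mset (inst (Fun c []) B) \<Gamma>0, \<Delta>0)" ?\<tau>])
        (use GD sub refut fresh in \<open>auto simp: Ex_L subset_insertI2 rename_fm_inst_fresh
            rename_fm_upd_fresh is_D_subst simp del: fun_upd_apply\<close>)
    then show ?thesis
      by (rule derivable_Ex_L) (use sub c' in \<open>auto simp: Ex_L\<close>)
  next
    case (All_R c \<Gamma>0 B \<Delta>0)
    with GD show ?thesis by simp
  qed
qed

theorem theorem1:
  fixes L :: "('f, 'p) lang"
    and \<Gamma> :: "('f, 'p) fm multiset"
    and G :: "('f, 'p) fm"
  assumes "infinite (constants L)"
    and "\<forall>B \<in># \<Gamma>. wf_fm L B \<and> is_D B"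
    and "wf_fm L G" and "is_G G"
  shows "c_entails L \<Gamma> G \<longleftrightarrow> i_entails L (add_mset (Imp G Fls) \<Gamma>) G"
proof
  assume "c_entails L \<Gamma> G"
  then have "c_derivable L (\<Gamma>, {#G#})"
    by (simp add: c_entails_iff_derivable)
  then have "i_derivable L (add_mset (Imp G Fls) \<Gamma>) Fls"
    by (rule c_derivable_imp_i_derivable_Fls[OF assms(1), where \<sigma> = "\<lambda>c. c"])
      (use assms in \<open>auto simp: refutable_Imp\<close>)
  then show "i_entails L (add_mset (Imp G Fls) \<Gamma>) G"
    unfolding i_entails_iff_derivable by (rule i_derivable_Fls_R)
next
  assume "i_entails L (add_mset (Imp G Fls) \<Gamma>) G"
  then have "c_derivable L (add_mset (Imp G Fls) \<Gamma>, {#G#})"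
    by (auto simp: i_entails_iff_derivable intro: derivable_mono)
  then have "c_derivable L (\<Gamma>, {#G#})"
    \<comment> \<open>The negation of \<open>G\<close> is matched by \<open>G\<close> in the
      succedent, everything else by itself.\<close>
    by (rule c_derivable_negations_to_right[OF assms(1), where \<sigma> = "\<lambda>c. c"]) auto
  then show "c_entails L \<Gamma> G"
    by (simp add: c_entails_iff_derivable)
qed

end
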